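(* For every integer $n\ge 0$, there is a bijection between the set of doubly rooted plane trees with $n$ edges and the set of bicolored plane trees with $n$ edges.
   Context: A plane tree is a rooted tree in which the children of each vertex are linearly ordered. A doubly rooted plane tree is a plane tree together with a distinguished vertex (possibly the root). A bicolored plane tree is a plane tree in which each child of the root is colored with one of two colors (black or white); no other vertices are colored. *)

theory Defs
  imports Main
begin

text \<open>
  The datatype contains exactly one representative of each isomorphism class of plane trees:
  a tree is the ordered list of the subtrees hanging off the children of its root.
\<close>

datatype plane_tree = Node (subtrees: "plane_tree list")

fun num_edges :: "plane_tree \<Rightarrow> nat" where
  "num_edges (Node ts) = (\<Sum>t\<leftarrow>ts. Suc (num_edges t))"

text \<open>
  A vertex is identified with the sequence of child positions on the path leading to it from
  the root; the root is the empty sequence.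
\<close>

function vertices :: "plane_tree \<Rightarrow> nat list set" where
  "vertices (Node ts) = insert [] (\<Union>i\<in>{..<length ts}. (#) i ` vertices (ts ! i))"
  by pat_completeness auto
termination
  by (relation "measure size") (auto simp: less_Suc_eq_le intro!: size_list_estimation' nth_mem)

lemma finite_vertices: "finite (vertices t)"
  by (induction t) auto

lemma card_vertices: "card (vertices t) = Suc (num_edges t)"
proof (induction t)
  case (Node ts)
  have "card (\<Union>i<length ts. (#) i ` vertices (ts ! i))
      = (\<Sum>i<length ts. card ((#) i ` vertices (ts ! i)))"
    by (rule card_UN_disjoint) (auto simp: finite_vertices)
  also have "\<dots> = (\<Sum>i<length ts. Suc (num_edges (ts ! i)))"
    by (rule sum.cong) (auto simp: card_image Node)
  also have "\<dots> = num_edges (Node ts)"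
    by (simp add: sum_list_sum_nth atLeast0LessThan)
  finally have "card (\<Union>i<length ts. (#) i ` vertices (ts ! i)) = num_edges (Node ts)" .
  moreover have "[] \<notin> (\<Union>i<length ts. (#) i ` vertices (ts ! i))" by auto
  moreover have "finite (\<Union>i<length ts. (#) i ` vertices (ts ! i))"
    by (auto simp: finite_vertices)
  ultimately show ?case by simp
qed

definition doubly_rooted_plane_trees :: "nat \<Rightarrow> (plane_tree \<times> nat list) set" where
  "doubly_rooted_plane_trees n = {(t, v). num_edges t = n \<and> v \<in> vertices t}"

datatype color = Black | White

text \<open>The \<open>i\<close>-th entry of \<open>cs\<close> is the color of the \<open>i\<close>-th child of the root of \<open>t\<close>.\<close>

definition bicolored_plane_trees :: "nat \<Rightarrow> (plane_tree \<times> color list) set" where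
  "bicolored_plane_trees n = {(t, cs). num_edges t = n \<and> length cs = length (subtrees t)}"

end

theory Submission
  imports Defs
begin

text \<open>
  Cut the path from the root to the distinguished vertex. If its first edge leads to the subtree
  \<open>t\<close>, the root has the subtrees \<open>ls @ t # rs\<close>; record \<open>ls\<close> as black
  trees, followed by the single white tree \<open>Node rs\<close>, followed by the encoding of \<open>t\<close>.
  The children of the distinguished vertex itself are recorded as black trees. Each white tree
  replaces one edge of the path, so the number of edges is preserved, and the first white tree
  of a colored sequence shows where to cut, so the construction can be undone.
\<close>

fun colored_of_rooted :: "plane_tree \<Rightarrow> nat list \<Rightarrow> (plane_tree \<times> color) list" where
  "colored_of_rooted (Node ts) [] = map (\<lambda>t. (t, Black)) ts"
| "colored_of_rooted (Node []) (i # v) = []"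
| "colored_of_rooted (Node (t # ts)) (0 # v) = (Node ts, White) # colored_of_rooted t v"
| "colored_of_rooted (Node (t # ts)) (Suc i # v) = (t, Black) # colored_of_rooted (Node ts) (i # v)"

text \<open>Undoes the removal of one black entry: a new leftmost child shifts the first step of a
  nonempty path.\<close>

fun add_left_subtree :: "plane_tree \<Rightarrow> plane_tree \<times> nat list \<Rightarrow> plane_tree \<times> nat list" where
  "add_left_subtree t (Node ts, []) = (Node (t # ts), [])"
| "add_left_subtree t (Node ts, i # v) = (Node (t # ts), Suc i # v)"

text \<open>The entries after a white tree decode to the subtree \<open>s\<close> that the path
  enters, with the marked vertex \<open>v\<close> in it. The white tree stores the right siblings of
  \<open>s\<close>; black entries before it become left siblings.\<close>

fun rooted_of_colored :: "(plane_tree \<times> color) list \<Rightarrow> plane_tree \<times> nat list" where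
  "rooted_of_colored [] = (Node [], [])"
| "rooted_of_colored ((t, Black) # xs) = add_left_subtree t (rooted_of_colored xs)"
| "rooted_of_colored ((t, White) # xs) =
    (case rooted_of_colored xs of (s, v) \<Rightarrow> (Node (s # subtrees t), 0 # v))"

lemma Nil_in_vertices [simp]: "[] \<in> vertices t"
  by (cases t) simp

lemma Cons_in_vertices [simp]:
  "i # v \<in> vertices (Node ts) \<longleftrightarrow> i < length ts \<and> v \<in> vertices (ts ! i)"
  by auto

declare vertices.simps [simp del]

lemma num_edges_colored_of_rooted:
  "v \<in> vertices t \<Longrightarrow> num_edges (Node (map fst (colored_of_rooted t v))) = num_edges t"
  by (induction t v rule: colored_of_rooted.induct) (auto simp: comp_def)

lemma rooted_of_colored_Black: "rooted_of_colored (map (\<lambda>t. (t, Black)) ts) = (Node ts, [])"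
  by (induction ts) auto

text \<open>Membership rules out an index past the last child, which the encoding would
  forget.\<close>

lemma rooted_of_colored_of_rooted:
  "v \<in> vertices t \<Longrightarrow> rooted_of_colored (colored_of_rooted t v) = (t, v)"
  by (induction t v rule: colored_of_rooted.induct) (auto simp: rooted_of_colored_Black)

lemma colored_of_rooted_add_left_subtree:
  "case_prod colored_of_rooted (add_left_subtree t p) = (t, Black) # case_prod colored_of_rooted p"
  by (induction t p rule: add_left_subtree.induct) auto

lemma colored_of_rooted_of_colored:
  "case_prod colored_of_rooted (rooted_of_colored xs) = xs"
  by (induction xs rule: rooted_of_colored.induct)
    (auto simp: colored_of_rooted_add_left_subtree split: prod.splits)

lemma add_left_subtree_in_vertices:
  "snd p \<in> vertices (fst p) \<Longrightarrow> snd (add_left_subtree t p) \<in> vertices (fst (add_left_subtree t p))"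
  by (induction t p rule: add_left_subtree.induct) auto

lemma rooted_of_colored_in_vertices:
  "snd (rooted_of_colored xs) \<in> vertices (fst (rooted_of_colored xs))"
  by (induction xs rule: rooted_of_colored.induct)
    (auto simp: add_left_subtree_in_vertices split: prod.splits)

text \<open>No new induction: the edge count for the encoding applies to the decoded pair, whose
  encoding is \<open>xs\<close> again.\<close>

lemma num_edges_rooted_of_colored:
  "num_edges (fst (rooted_of_colored xs)) = num_edges (Node (map fst xs))"
  using num_edges_colored_of_rooted[OF rooted_of_colored_in_vertices, of xs]
    colored_of_rooted_of_colored[of xs]
  by (simp add: case_prod_beta)

theorem theorem2p3:
  fixes n :: nat
  shows "\<exists>f. bij_betw f (doubly_rooted_plane_trees n) (bicolored_plane_trees n)"
proof
  \<comment> \<open>A bicolored tree is a list of colored trees, unzipped into the subtrees of the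
    root and their colors.\<close>
  let ?f = "\<lambda>(t, v). (Node (map fst (colored_of_rooted t v)), map snd (colored_of_rooted t v))"
  let ?g = "\<lambda>(t, cs). rooted_of_colored (zip (subtrees t) cs)"
  show "bij_betw ?f (doubly_rooted_plane_trees n) (bicolored_plane_trees n)"
  proof (rule bij_betw_byWitness[where f' = ?g])
    show "\<forall>p\<in>doubly_rooted_plane_trees n. ?g (?f p) = p"
      by (auto simp: doubly_rooted_plane_trees_def zip_map_fst_snd rooted_of_colored_of_rooted)
    show "\<forall>q\<in>bicolored_plane_trees n. ?f (?g q) = q"
    proof
      fix q assume "q \<in> bicolored_plane_trees n"
      then obtain t cs where q: "q = (t, cs)" "length cs = length (subtrees t)"
        by (auto simp: bicolored_plane_trees_def)
      \<comment> \<open>Equal lengths ensure that \<open>zip\<close> loses neither a subtree nor a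
        color.\<close>
      then show "?f (?g q) = q"
        using colored_of_rooted_of_colored[of "zip (subtrees t) cs"]
        by (simp add: case_prod_beta)
    qed
    show "?f ` doubly_rooted_plane_trees n \<subseteq> bicolored_plane_trees n"
      using num_edges_colored_of_rooted
      by (auto simp: doubly_rooted_plane_trees_def bicolored_plane_trees_def simp del: num_edges.simps)
    show "?g ` bicolored_plane_trees n \<subseteq> doubly_rooted_plane_trees n"
    proof (rule image_subsetI)
      fix q assume "q \<in> bicolored_plane_trees n"
      then obtain t cs where "q = (t, cs)" "length cs = length (subtrees t)" "num_edges t = n"
        by (auto simp: bicolored_plane_trees_def)
      then show "?g q \<in> doubly_rooted_plane_trees n"
        by (simp add: doubly_rooted_plane_trees_def case_prod_beta rooted_of_colored_in_vertices
            num_edges_rooted_of_colored del: num_edges.simps)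
    qed
  qed
qed

end
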